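(* Let $K, C \subset \mathbb{R}^d$ be convex bodies. Then $$\frac{r_1(K,C)}{r(K,C)} \le \frac{(s(K)+1)\,s(C)}{s(C)+1},$$ and for every $\sigma_K,\sigma_C \in [1,d]$ there exist convex bodies $K, C\subset\mathbb{R}^d$ with $s(K)=\sigma_K$ and $s(C)=\sigma_C$ for which this inequality is tight (holds with equality).
   Context: A convex body in $\mathbb{R}^d$ is a non-empty compact convex set (not necessarily full-dimensional, not necessarily symmetric). For non-empty closed convex $K,C\subset\mathbb{R}^d$: - $C$-radius: $R(K,C) := \inf\{\rho\ge 0 : \exists c\in\mathbb{R}^d \text{ such that } K\subset c+\rho C\}\in[0,\infty]$ (with $\inf\emptyset=\infty$). - $C$-inradius: $r(K,C) := \sup\{\rho\ge 0 : \exists c\in\mathbb{R}^d \text{ such that } c+\rho C\subset K\}$. - $r_1(K,C) := \inf\left\{\frac{h(K-K,a)}{h(C-C,a)} : a\in\mathbb{R}^d\setminus\{0\}\right\}$ (half the $C$-width of $K$), where $h(A,a)=\sup\{a^Tx:x\in A\}$ is the support function, $A-A=\{x-y:x,y\in A\}$, and inside this infimum $\alpha/\beta:=\infty$ whenever $\alpha=\infty$ or $\beta=0$, and $\alpha/\beta:=0$ if $\alpha\neq\beta=\infty$. - Minkowski asymmetry: $s(K) := R(-K,K)$, where $-K=\{-x:x\in K\}$. Convention: the ratio $r_1(K,C)/r(K,C)$ is taken to be $1$ if it is of the form $0/0$ or $\infty/\infty$.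
   Formalization: The inequality is stated only for convex bodies K, C that are not single points; for a single point s = 0 and the ratio is 1 by convention while the right side is below 1, so the claim as written fails there. *)

theory Defs
  imports "HOL-Analysis.Analysis"
begin

definition convex_body :: "'a::euclidean_space set \<Rightarrow> bool" where
  "convex_body K \<longleftrightarrow> K \<noteq> {} \<and> compact K \<and> convex K"

definition homothet :: "'a::euclidean_space \<Rightarrow> real \<Rightarrow> 'a set \<Rightarrow> 'a set" where
  "homothet c \<rho> C = (\<lambda>x. c + \<rho> *\<^sub>R x) ` C"

definition difference_body :: "'a::euclidean_space set \<Rightarrow> 'a set" where
  "difference_body A = {x - y | x y. x \<in> A \<and> y \<in> A}"

definition support_fun :: "'a::euclidean_space set \<Rightarrow> 'a \<Rightarrow> ereal" where
  "support_fun A a = (SUP x\<in>A. ereal (a \<bullet> x))"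

text \<open>The infimum of the empty set of extended reals is \<open>\<infinity>\<close>, as the definition requires.\<close>

definition circumradius :: "'a::euclidean_space set \<Rightarrow> 'a set \<Rightarrow> ereal" where
  "circumradius K C = Inf {ereal \<rho> | \<rho>. 0 \<le> \<rho> \<and> (\<exists>c. K \<subseteq> homothet c \<rho> C)}"

definition inradius :: "'a::euclidean_space set \<Rightarrow> 'a set \<Rightarrow> ereal" where
  "inradius K C = Sup {ereal \<rho> | \<rho>. 0 \<le> \<rho> \<and> (\<exists>c. homothet c \<rho> C \<subseteq> K)}"

text \<open>The quotient convention used only inside the infimum defining \<open>half_width\<close>; it differs
  from \<^typ>\<open>ereal\<close> division, for which \<open>0 / 0 = 0\<close>.\<close>

definition width_quot :: "ereal \<Rightarrow> ereal \<Rightarrow> ereal" where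
  "width_quot \<alpha> \<beta> =
     (if \<alpha> = \<infinity> \<or> \<beta> = 0 then \<infinity> else if \<beta> = \<infinity> then 0 else \<alpha> / \<beta>)"

text \<open>Half the \<open>C\<close>-width of \<open>K\<close>, usually written \<open>r\<^sub>1(K,C)\<close>.\<close>

definition half_width :: "'a::euclidean_space set \<Rightarrow> 'a set \<Rightarrow> ereal" where
  "half_width K C =
     (INF a\<in>- {0}. width_quot (support_fun (difference_body K) a)
                             (support_fun (difference_body C) a))"

definition minkowski_asymmetry :: "'a::euclidean_space set \<Rightarrow> ereal" where
  "minkowski_asymmetry K = circumradius (uminus ` K) K"

text \<open>The ratio \<open>r\<^sub>1(K,C) / r(K,C)\<close>, with \<open>0 / 0\<close> and \<open>\<infinity> / \<infinity>\<close> read as \<open>1\<close>; otherwise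
  \<^typ>\<open>ereal\<close> division is the intended one (a positive number divided by \<open>0\<close> is \<open>\<infinity>\<close>).\<close>

definition width_inradius_ratio :: "'a::euclidean_space set \<Rightarrow> 'a set \<Rightarrow> ereal" where
  "width_inradius_ratio K C =
     (if half_width K C = 0 \<and> inradius K C = 0 \<or> half_width K C = \<infinity> \<and> inradius K C = \<infinity>
      then 1 else half_width K C / inradius K C)"

text \<open>By definition a single point has asymmetry \<open>0\<close>, outside the range \<open>[1, d]\<close> of all other
  convex bodies.  If \<open>K\<close> or \<open>C\<close> is a single point, then the ratio above is \<open>1\<close> by convention
  while \<open>(s(K) + 1) s(C) / (s(C) + 1) < 1\<close>; so single points have to be excluded from an
  upper bound of this form.\<close>

lemma minkowski_asymmetry_singleton: "minkowski_asymmetry {x} = 0"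
proof (rule antisym)
  have "uminus ` {x} \<subseteq> homothet (- x) 0 {x}"
    by (simp add: homothet_def)
  then show "minkowski_asymmetry {x} \<le> 0"
    unfolding minkowski_asymmetry_def circumradius_def zero_ereal_def
    by (intro Inf_lower) blast
  show "0 \<le> minkowski_asymmetry {x}"
    unfolding minkowski_asymmetry_def circumradius_def
    by (intro Inf_greatest) auto
qed

end

theory Submission
  imports Defs
begin

text \<open>
  For the upper bound, write \<open>s\<close> and \<open>t\<close> for the asymmetries of \<open>K\<close> and \<open>C\<close>.  From
  \<open>- K \<subseteq> c + s K\<close> one gets that \<open>K - K\<close> lies in a translate of \<open>(s + 1) K\<close>, and from
  \<open>- C \<subseteq> e + t C\<close>, read backwards, that \<open>C - C\<close> contains a translate of \<open>((t + 1) / t) C\<close>.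
  By separation, \<open>\<rho> \<le> r\<^sub>1(K,C)\<close> means \<open>\<rho> (C - C) \<subseteq> K - K\<close> (\<open>half_width_ge_iff\<close>).
  Chaining the three containments puts a translate of \<open>(\<rho> (t + 1) / (t (s + 1))) C\<close> into \<open>K\<close>
  (\<open>homothet_subset_of_difference_body\<close>), so that
  \<open>r(K,C) \<ge> r\<^sub>1(K,C) (t + 1) / (t (s + 1))\<close>.

  For sharpness, let \<open>T\<close> be the simplex \<open>{x. \<forall>i. a\<^sub>i \<bullet> x \<le> 1}\<close> with \<open>\<Sum>i. a\<^sub>i = 0\<close> and vertices
  \<open>v\<^sub>i\<close> normalised by \<open>a\<^sub>i \<bullet> v\<^sub>j = 1\<close> for \<open>i \<noteq> j\<close> and \<open>a\<^sub>i \<bullet> v\<^sub>i = - d\<close>.  Take for \<open>K\<close> a large body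
  of asymmetry \<open>s\<close>, the intersection of \<open>T\<close> with \<open>- s T\<close>, and for \<open>C\<close> a small body of asymmetry
  \<open>t\<close> with the opposite orientation, the convex hull of the points \<open>- (t / d) v\<^sub>i\<close> and
  \<open>(1 / d) v\<^sub>i\<close>.  All optimality claims come from one principle (\<open>translate_bound\<close>): since the
  \<open>a\<^sub>i\<close> sum to zero, no translation decreases all support values \<open>h(A, a\<^sub>i)\<close> at the same time.  It yields
  \<open>s(K) = s\<close>, \<open>s(C) = t\<close> and \<open>r(K,C) \<le> 1 / t\<close>.  On the other hand every difference of two
  vertices of \<open>C\<close>, scaled by \<open>(s + 1) / (t + 1)\<close>, lies in \<open>K - K\<close>, so that
  \<open>r\<^sub>1(K,C) \<ge> (s + 1) / (t + 1)\<close>, and the quotient reaches the upper bound.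
\<close>

section \<open>Homothets, asymmetry and inradius\<close>

lemma inradius_ge:
  assumes "0 \<le> \<rho>" "homothet c \<rho> C \<subseteq> K"
  shows "ereal \<rho> \<le> inradius K C"
  unfolding inradius_def using assms by (intro Sup_upper) blast

lemma inradius_nonneg:
  assumes "K \<noteq> {}"
  shows "0 \<le> inradius K C"
proof -
  obtain c where "c \<in> K" using assms by blast
  then have "homothet c 0 C \<subseteq> K"
    by (auto simp: homothet_def)
  from inradius_ge[OF order_refl this] show ?thesis
    by (simp add: zero_ereal_def)
qed

lemma inradius_le:
  assumes "\<And>\<rho> c. 0 \<le> \<rho> \<Longrightarrow> homothet c \<rho> C \<subseteq> K \<Longrightarrow> \<rho> \<le> x"
  shows "inradius K C \<le> ereal x"
  unfolding inradius_def using assms by (intro Sup_least) auto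

lemma minkowski_asymmetry_le:
  assumes "0 \<le> \<rho>" "uminus ` K \<subseteq> homothet c \<rho> K"
  shows "minkowski_asymmetry K \<le> ereal \<rho>"
  unfolding minkowski_asymmetry_def circumradius_def using assms
  by (intro Inf_lower) blast

lemma minkowski_asymmetry_ge:
  assumes "\<And>\<rho> c. 0 \<le> \<rho> \<Longrightarrow> uminus ` K \<subseteq> homothet c \<rho> K \<Longrightarrow> x \<le> \<rho>"
  shows "ereal x \<le> minkowski_asymmetry K"
  unfolding minkowski_asymmetry_def circumradius_def using assms
  by (intro Inf_greatest) auto

text \<open>Compare diameters: a homothet of ratio \<open>\<rho>\<close> multiplies the diameter by \<open>\<rho>\<close>, and the diameter of
  \<open>- K\<close> is that of \<open>K\<close>, which is positive for a body that is not a point.\<close>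

lemma one_le_asymmetry_factor:
  assumes "convex_body K" "\<not> is_singleton K" "0 \<le> \<rho>" "uminus ` K \<subseteq> homothet c \<rho> K"
  shows "1 \<le> \<rho>"
proof -
  have K: "compact K" "K \<noteq> {}" using assms(1) by (auto simp: convex_body_def)
  obtain p q where pq: "p \<in> K" "q \<in> K" "dist p q = diameter K"
    using diameter_compact_attained[OF K] by blast
  obtain u v where uv: "u \<in> K" "v \<in> K" "u \<noteq> v"
    using assms(2) K(2) by (meson is_singletonI')
  have bd: "dist x y \<le> diameter K" if "x \<in> K" "y \<in> K" for x y
    using diameter_bounded_bound[OF compact_imp_bounded[OF K(1)]] that by blast
  have pos: "0 < diameter K"
    using bd[OF uv(1,2)] uv(3) by (metis zero_less_dist_iff less_le_trans)
  obtain p' q' where p': "p' \<in> K" "- p = c + \<rho> *\<^sub>R p'" and q': "q' \<in> K" "- q = c + \<rho> *\<^sub>R q'"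
    using assms(4) pq(1,2) unfolding homothet_def by blast
  have "diameter K = dist (- p) (- q)"
    using pq(3) by (simp add: dist_minus)
  also have "\<dots> = \<rho> * dist p' q'"
    using p'(2) q'(2) assms(3) by (simp add: dist_norm flip: scaleR_diff_right)
  also have "\<dots> \<le> \<rho> * diameter K"
    using bd[OF p'(1) q'(1)] assms(3) by (simp add: mult_left_mono)
  finally show ?thesis using pos by simp
qed

text \<open>A body need not have interior points, but it has a relative interior point \<open>z\<close>: reflecting \<open>K\<close>
  in \<open>z\<close> stays within the affine hull of \<open>K\<close>, so a contraction with centre \<open>z\<close> brings the
  reflected body into \<open>K\<close>.\<close>

lemma asymmetry_factor_exists:
  fixes K :: "'a::euclidean_space set"
  assumes "convex_body K"
  obtains \<rho> c where "0 \<le> \<rho>" "uminus ` K \<subseteq> homothet c \<rho> K"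
proof -
  have K: "compact K" "K \<noteq> {}" "convex K" using assms by (auto simp: convex_body_def)
  obtain z where "z \<in> rel_interior K"
    using K rel_interior_eq_empty by blast
  then obtain e where e: "e > 0" "cball z e \<inter> affine hull K \<subseteq> K" and z: "z \<in> K"
    by (auto simp: mem_rel_interior_cball)
  obtain M where M: "M > 0" "\<And>x. x \<in> K \<Longrightarrow> dist z x \<le> M"
    using bounded_any_center[of K z] compact_imp_bounded[OF K(1)]
    by (metis dist_commute gt_ex less_le_trans less_imp_le order_trans linorder_not_le)
  define \<rho> where "\<rho> = M / e"
  have \<rho>: "\<rho> > 0" using e M by (simp add: \<rho>_def)
  have "uminus ` K \<subseteq> homothet (- z - \<rho> *\<^sub>R z) \<rho> K"
  proof clarify
    fix x assume x: "x \<in> K"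
    define y where "y = (1 + 1 / \<rho>) *\<^sub>R z + (- (1 / \<rho>)) *\<^sub>R x"
    have yz: "y - z = (1 / \<rho>) *\<^sub>R (z - x)"
      by (simp add: y_def algebra_simps)
    have "dist z y = (1 / \<rho>) * dist z x"
      using \<rho> by (simp add: dist_norm norm_minus_commute[of z y] yz)
    also have "\<dots> \<le> (1 / \<rho>) * M"
      using \<rho> M(2)[OF x] by (simp add: divide_right_mono)
    also have "\<dots> = e" using M e by (simp add: \<rho>_def)
    finally have "y \<in> cball z e" by simp
    moreover have "y \<in> affine hull K"
      unfolding y_def
      by (rule mem_affine) (auto intro: hull_inc x z)
    ultimately have "y \<in> K" using e by blast
    moreover have "- x = - z - \<rho> *\<^sub>R z + \<rho> *\<^sub>R y"
    proof -
      have "\<rho> *\<^sub>R (y - z) = z - x" using \<rho> by (simp add: yz)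
      then show ?thesis by (simp add: algebra_simps)
    qed
    ultimately show "- x \<in> homothet (- z - \<rho> *\<^sub>R z) \<rho> K"
      unfolding homothet_def by blast
  qed
  with \<rho> show ?thesis by (intro that) auto
qed

lemma minkowski_asymmetry_real:
  assumes "convex_body K" "\<not> is_singleton K"
  obtains s where "minkowski_asymmetry K = ereal s" "1 \<le> s"
proof -
  obtain \<rho> c where "0 \<le> \<rho>" "uminus ` K \<subseteq> homothet c \<rho> K"
    using asymmetry_factor_exists[OF assms(1)] .
  then have "minkowski_asymmetry K \<le> ereal \<rho>" by (rule minkowski_asymmetry_le)
  moreover have "ereal 1 \<le> minkowski_asymmetry K"
    using one_le_asymmetry_factor[OF assms] by (rule minkowski_asymmetry_ge)
  ultimately show ?thesis
    using that by (cases "minkowski_asymmetry K") auto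
qed

section \<open>The width as a containment of difference bodies\<close>

lemma convex_body_difference_body:
  assumes "convex_body K"
  shows "convex_body (difference_body K)" "0 \<in> difference_body K"
    "\<And>x. x \<in> difference_body K \<Longrightarrow> - x \<in> difference_body K"
proof -
  have K: "compact K" "K \<noteq> {}" "convex K" using assms by (auto simp: convex_body_def)
  have "difference_body K = (\<Union>x\<in>K. \<Union>y\<in>K. {x - y})"
    by (auto simp: difference_body_def)
  then have "convex (difference_body K)"
    using convex_differences[OF K(3) K(3)] by simp
  moreover have "compact (difference_body K)"
    unfolding difference_body_def using compact_differences[OF K(1) K(1)] by simp
  moreover show 0: "0 \<in> difference_body K"
    using K(2) by (force simp: difference_body_def)
  ultimately show "convex_body (difference_body K)"
    by (auto simp: convex_body_def)
  fix x assume "x \<in> difference_body K"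
  then obtain u v where "x = u - v" "u \<in> K" "v \<in> K"
    by (auto simp: difference_body_def)
  then have "- x = v - u" "u \<in> K" "v \<in> K" by auto
  then show "- x \<in> difference_body K"
    unfolding difference_body_def by blast
qed

lemma support_fun_attained:
  assumes "compact A" "A \<noteq> {}"
  obtains x where "x \<in> A" "support_fun A a = ereal (a \<bullet> x)" "\<And>y. y \<in> A \<Longrightarrow> a \<bullet> y \<le> a \<bullet> x"
proof -
  have "continuous_on A (\<lambda>x. a \<bullet> x)" by (intro continuous_intros)
  from continuous_attains_sup[OF assms this]
  obtain x where x: "x \<in> A" "\<And>y. y \<in> A \<Longrightarrow> a \<bullet> y \<le> a \<bullet> x" by blast
  have "support_fun A a = ereal (a \<bullet> x)"
    unfolding support_fun_def
  proof (rule antisym)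
    show "(SUP y\<in>A. ereal (a \<bullet> y)) \<le> ereal (a \<bullet> x)"
      using x by (intro SUP_least) simp
    show "ereal (a \<bullet> x) \<le> (SUP y\<in>A. ereal (a \<bullet> y))"
      using x by (intro SUP_upper)
  qed
  with x show ?thesis by (intro that)
qed

text \<open>A closed convex set is the intersection of its supporting half-spaces, so comparing all support
  values of the two difference bodies is the same as comparing the bodies.  Directions in which
  \<open>C\<close> has width \<open>0\<close>, where the quotient is infinite, impose no condition on either side.\<close>

lemma half_width_ge_iff:
  fixes K C :: "'a::euclidean_space set"
  assumes K: "convex_body K" and C: "convex_body C" and \<rho>: "0 \<le> \<rho>"
  shows "ereal \<rho> \<le> half_width K C \<longleftrightarrow>
    (\<forall>z \<in> difference_body C. \<rho> *\<^sub>R z \<in> difference_body K)"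
proof -
  note DK = convex_body_difference_body[OF K]
  note DC = convex_body_difference_body[OF C]
  have quot: "ereal \<rho> \<le> width_quot (support_fun (difference_body K) a) (support_fun (difference_body C) a)
      \<longleftrightarrow> (\<forall>z \<in> difference_body C. \<exists>w \<in> difference_body K. \<rho> * (a \<bullet> z) \<le> a \<bullet> w)" for a
  proof -
    obtain w where w: "w \<in> difference_body K" "support_fun (difference_body K) a = ereal (a \<bullet> w)"
      "\<And>y. y \<in> difference_body K \<Longrightarrow> a \<bullet> y \<le> a \<bullet> w"
      using support_fun_attained[of "difference_body K" a] DK by (auto simp: convex_body_def)
    obtain z where z: "z \<in> difference_body C" "support_fun (difference_body C) a = ereal (a \<bullet> z)"
      "\<And>y. y \<in> difference_body C \<Longrightarrow> a \<bullet> y \<le> a \<bullet> z"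
      using support_fun_attained[of "difference_body C" a] DC by (auto simp: convex_body_def)
    have nonneg: "0 \<le> a \<bullet> w" "0 \<le> a \<bullet> z"
      using w(3)[OF DK(2)] z(3)[OF DC(2)] by auto
    have "ereal \<rho> \<le> width_quot (ereal (a \<bullet> w)) (ereal (a \<bullet> z)) \<longleftrightarrow> \<rho> * (a \<bullet> z) \<le> a \<bullet> w"
      using nonneg by (auto simp: width_quot_def field_simps)
    also have "\<dots> \<longleftrightarrow> (\<forall>z \<in> difference_body C. \<exists>w \<in> difference_body K. \<rho> * (a \<bullet> z) \<le> a \<bullet> w)"
      using w z \<rho> by (meson mult_left_mono order_trans)
    finally show ?thesis by (simp add: w z)
  qed
  show ?thesis
  proof
    assume le: "ereal \<rho> \<le> half_width K C"
    show "\<forall>z \<in> difference_body C. \<rho> *\<^sub>R z \<in> difference_body K"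
    proof (rule ccontr)
      assume "\<not> ?thesis"
      then obtain z where z: "z \<in> difference_body C" "\<rho> *\<^sub>R z \<notin> difference_body K" by blast
      obtain b \<beta> where b: "b \<bullet> (\<rho> *\<^sub>R z) < \<beta>" "\<And>w. w \<in> difference_body K \<Longrightarrow> \<beta> < b \<bullet> w"
        using separating_hyperplane_closed_point[of "difference_body K" "\<rho> *\<^sub>R z"] z(2) DK(1)
        by (auto simp: convex_body_def compact_imp_closed)
      have "- b \<noteq> 0" using b(1) b(2)[OF DK(2)] by auto
      then have "ereal \<rho> \<le> width_quot (support_fun (difference_body K) (- b))
          (support_fun (difference_body C) (- b))"
        using le unfolding half_width_def by (meson INF_lower order_trans ComplI singletonD)
      then obtain w where "w \<in> difference_body K" "\<rho> * (- b \<bullet> z) \<le> - b \<bullet> w"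
        unfolding quot using z(1) by blast
      with b(1) b(2)[of w] show False by simp
    qed
  next
    assume sub: "\<forall>z \<in> difference_body C. \<rho> *\<^sub>R z \<in> difference_body K"
    show "ereal \<rho> \<le> half_width K C"
      unfolding half_width_def
    proof (intro INF_greatest, unfold quot, intro ballI)
      fix a z assume "z \<in> difference_body C"
      with sub show "\<exists>w \<in> difference_body K. \<rho> * (a \<bullet> z) \<le> a \<bullet> w"
        by (intro bexI[of _ "\<rho> *\<^sub>R z"]) auto
    qed
  qed
qed

section \<open>The upper bound\<close>

text \<open>For \<open>x \<in> C\<close>, the point \<open>y = - (x + e) / t\<close> is in \<open>C\<close> and \<open>x - y\<close> is \<open>((t + 1) / t) x\<close> up to a
  constant.  By hypothesis \<open>\<rho> (x - y) = p - q\<close> with \<open>p, q \<in> K\<close>; replacing \<open>- q\<close> by \<open>c + s r\<close> with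
  \<open>r \<in> K\<close> turns this into \<open>c\<close> plus \<open>s + 1\<close> times the convex combination
  \<open>(p + s r) / (s + 1)\<close>, a point of \<open>K\<close>.\<close>

lemma homothet_subset_of_difference_body:
  assumes K: "convex K" and s: "0 \<le> s" "uminus ` K \<subseteq> homothet c s K"
    and t: "0 < t" "uminus ` C \<subseteq> homothet e t C"
    and sub: "\<And>z. z \<in> difference_body C \<Longrightarrow> \<rho> *\<^sub>R z \<in> difference_body K"
  shows "\<exists>b. homothet b (\<rho> * (t + 1) / (t * (s + 1))) C \<subseteq> K"
proof
  show "homothet ((1 / (s + 1)) *\<^sub>R ((\<rho> / t) *\<^sub>R e - c)) (\<rho> * (t + 1) / (t * (s + 1))) C \<subseteq> K"
    (is "homothet ?b ?k C \<subseteq> K")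
  proof
    fix u assume "u \<in> homothet ?b ?k C"
    then obtain x where x: "x \<in> C" "u = ?b + ?k *\<^sub>R x"
      by (auto simp: homothet_def)
    obtain y where y: "y \<in> C" "- x = e + t *\<^sub>R y"
      using t(2) x(1) by (auto simp: homothet_def)
    have "x - y \<in> difference_body C" using x(1) y(1) by (auto simp: difference_body_def)
    from sub[OF this] obtain p q where pq: "p \<in> K" "q \<in> K" "\<rho> *\<^sub>R (x - y) = p - q"
      by (auto simp: difference_body_def)
    obtain r where r: "r \<in> K" "- q = c + s *\<^sub>R r"
      using s(2) pq(2) by (auto simp: homothet_def)
    have y': "y = - (1 / t) *\<^sub>R (x + e)"
    proof -
      have "t *\<^sub>R y = - x - e" by (simp add: y(2))
      then have "t *\<^sub>R y = - (x + e)" by simp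
      then have "(1 / t) *\<^sub>R (t *\<^sub>R y) = (1 / t) *\<^sub>R (- (x + e))" by simp
      with t(1) show ?thesis by (simp add: algebra_simps)
    qed
    have "p + s *\<^sub>R r = \<rho> *\<^sub>R (x - y) - c"
    proof -
      have "p - q = p + (c + s *\<^sub>R r)" by (simp flip: r(2))
      then show ?thesis by (simp add: pq(3))
    qed
    also have "\<dots> = (s + 1) *\<^sub>R u"
    proof -
      have "(s + 1) *\<^sub>R u = (\<rho> / t) *\<^sub>R e - c + (\<rho> * (t + 1) / t) *\<^sub>R x"
        using s(1) t(1) by (simp add: x(2) scaleR_add_right)
      also have "\<dots> = \<rho> *\<^sub>R (x - y) - c"
        using t(1) by (simp add: y' scaleR_add_right scaleR_diff_right add_divide_distrib
            distrib_left scaleR_add_left)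
      finally show ?thesis by simp
    qed
    finally have "u = (1 / (s + 1)) *\<^sub>R (p + s *\<^sub>R r)"
      using s(1) by simp
    also have "\<dots> = (1 / (s + 1)) *\<^sub>R p + (s / (s + 1)) *\<^sub>R r"
      by (simp add: scaleR_add_right)
    also have "\<dots> \<in> K"
      using K pq(1) r(1) s(1) by (intro convexD) (auto simp: field_simps)
    finally show "u \<in> K" .
  qed
qed

text \<open>Instead of showing that the infimum in the definition of the asymmetry is attained, the
  containment lemma is applied to every admissible pair of factors \<open>s'\<close>, \<open>t'\<close>, and the resulting
  inequality is solved first for \<open>s'\<close> and then for \<open>t'\<close>: each time the other side is a lower bound
  of all admissible factors, hence of their infimum.\<close>

lemma inradius_ge_half_width:
  fixes K C :: "'a::euclidean_space set"
  assumes K: "convex_body K" and C: "convex_body C" "\<not> is_singleton C"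
    and s: "minkowski_asymmetry K = ereal s" "1 \<le> s"
    and t: "minkowski_asymmetry C = ereal t" "1 \<le> t"
    and \<rho>: "0 \<le> \<rho>" "ereal \<rho> \<le> half_width K C"
  shows "ereal (\<rho> * (t + 1) / (t * (s + 1))) \<le> inradius K C"
proof (cases "inradius K C")
  case (real r)
  have factor: "\<rho> * (t' + 1) \<le> r * (t' * (s' + 1))"
    if s': "0 \<le> s'" "uminus ` K \<subseteq> homothet c s' K"
      and t': "0 \<le> t'" "uminus ` C \<subseteq> homothet e t' C" for s' t' c e
  proof -
    have "1 \<le> t'" using one_le_asymmetry_factor[OF C t'] .
    moreover have "\<exists>b. homothet b (\<rho> * (t' + 1) / (t' * (s' + 1))) C \<subseteq> K"
      using homothet_subset_of_difference_body[of K s' c t' C e \<rho>] K s' t' \<open>1 \<le> t'\<close>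
        half_width_ge_iff[OF K C(1) \<rho>(1)] \<rho>(2)
      by (auto simp: convex_body_def)
    ultimately have "ereal (\<rho> * (t' + 1) / (t' * (s' + 1))) \<le> inradius K C"
      using s'(1) \<rho>(1) by (auto intro!: inradius_ge)
    then show ?thesis
      using \<open>1 \<le> t'\<close> s'(1) by (simp add: real pos_divide_le_eq)
  qed
  have "0 \<le> r"
    using inradius_nonneg[of K C] K by (simp add: real convex_body_def)
  have step: "\<rho> * (t' + 1) \<le> r * (t' * (s + 1))"
    if t': "0 \<le> t'" "uminus ` C \<subseteq> homothet e t' C" for t' e
  proof (cases "r = 0")
    case True
    obtain s' c where "0 \<le> s'" "uminus ` K \<subseteq> homothet c s' K"
      using asymmetry_factor_exists[OF K] .
    from factor[OF this t'] True show ?thesis by simp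
  next
    case False
    have t1: "1 \<le> t'" using one_le_asymmetry_factor[OF C t'] .
    have "ereal (\<rho> * (t' + 1) / (r * t') - 1) \<le> minkowski_asymmetry K"
    proof (rule minkowski_asymmetry_ge)
      fix s' c assume "0 \<le> s'" "uminus ` K \<subseteq> homothet c s' K"
      from factor[OF this t'] show "\<rho> * (t' + 1) / (r * t') - 1 \<le> s'"
        using False \<open>0 \<le> r\<close> t1 by (simp add: field_simps)
    qed
    then show ?thesis
      using False \<open>0 \<le> r\<close> t1 by (simp add: s field_simps)
  qed
  have "\<rho> * (t + 1) \<le> r * (t * (s + 1))"
  proof -
    \<comment> \<open>This fraction is the solution \<open>t'\<close> of \<open>\<rho> (t' + 1) = r t' (s + 1)\<close>.\<close>
    have "ereal (\<rho> / (r * (s + 1) - \<rho>)) \<le> minkowski_asymmetry C" if "\<rho> < r * (s + 1)"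
    proof (rule minkowski_asymmetry_ge)
      fix t' e assume "0 \<le> t'" "uminus ` C \<subseteq> homothet e t' C"
      from step[OF this] show "\<rho> / (r * (s + 1) - \<rho>) \<le> t'"
        using that by (simp add: pos_divide_le_eq algebra_simps)
    qed
    moreover have "\<rho> < r * (s + 1)" if "\<rho> \<noteq> 0"
    proof -
      obtain t' e where t': "0 \<le> t'" "uminus ` C \<subseteq> homothet e t' C"
        using asymmetry_factor_exists[OF C(1)] .
      have t1: "1 \<le> t'" using one_le_asymmetry_factor[OF C t'] .
      have "t' * \<rho> < \<rho> * (t' + 1)" using that \<rho>(1) by (simp add: algebra_simps)
      also have "\<dots> \<le> t' * (r * (s + 1))" using step[OF t'] by (simp add: algebra_simps)
      finally show ?thesis using t1 by simp
    qed
    ultimately show ?thesis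
      using \<open>0 \<le> r\<close> s(2) t(2) by (cases "\<rho> = 0") (auto simp: t(1) pos_divide_le_eq algebra_simps)
  qed
  then show ?thesis
    using s(2) t(2) by (simp add: real pos_divide_le_eq)
next
  case MInf
  then show ?thesis using inradius_nonneg[of K C] K by (simp add: convex_body_def)
qed simp

text \<open>Since \<open>s, t \<ge> 1\<close>, the bound is at least \<open>1\<close>, which covers the two cases in which the ratio is
  \<open>1\<close> by convention.\<close>

theorem width_inradius_ratio_le:
  fixes K C :: "'a::euclidean_space set"
  assumes K: "convex_body K" "\<not> is_singleton K" and C: "convex_body C" "\<not> is_singleton C"
  shows "width_inradius_ratio K C
    \<le> (minkowski_asymmetry K + 1) * minkowski_asymmetry C / (minkowski_asymmetry C + 1)"
proof -
  obtain s where s: "minkowski_asymmetry K = ereal s" "1 \<le> s"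
    using minkowski_asymmetry_real[OF K] .
  obtain t where t: "minkowski_asymmetry C = ereal t" "1 \<le> t"
    using minkowski_asymmetry_real[OF C] .
  define k where "k = (t + 1) / (t * (s + 1))"
  have k: "0 < k" "k \<le> 1"
  proof -
    show "0 < k" using s t by (simp add: k_def)
    have "t + 1 \<le> t * 2" "t * 2 \<le> t * (s + 1)" using s t by auto
    then have "t + 1 \<le> t * (s + 1)" by linarith
    then show "k \<le> 1" using s t by (simp add: k_def)
  qed
  have rhs: "(minkowski_asymmetry K + 1) * minkowski_asymmetry C / (minkowski_asymmetry C + 1)
      = ereal (1 / k)"
    using s t by (simp add: k_def one_ereal_def mult.commute)
  have le: "ereal (\<rho> * k) \<le> inradius K C" if "0 \<le> \<rho>" "ereal \<rho> \<le> half_width K C" for \<rho>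
    using inradius_ge_half_width[OF K(1) C s t that] by (simp add: k_def)
  have w0: "0 \<le> half_width K C"
    using half_width_ge_iff[OF K(1) C(1), of 0] convex_body_difference_body[OF K(1)]
    by (simp add: zero_ereal_def)
  have r0: "0 \<le> inradius K C"
    using inradius_nonneg K by (auto simp: convex_body_def)
  show ?thesis
  proof (cases "half_width K C")
    case (real w)
    then have "0 \<le> w" using w0 by simp
    then have "ereal (w * k) \<le> inradius K C" using le[of w] real by simp
    then show ?thesis
      using k \<open>0 \<le> w\<close> r0 unfolding rhs width_inradius_ratio_def real
      by (cases "inradius K C") (auto simp: field_simps one_ereal_def mult_le_0_iff)
  next
    case PInf
    have "inradius K C = \<infinity>"
    proof (rule ereal_top)
      fix B
      have "ereal B \<le> ereal ((max 0 B / k) * k)" using k by simp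
      also have "\<dots> \<le> inradius K C" using PInf k by (intro le) auto
      finally show "ereal B \<le> inradius K C" .
    qed
    then show ?thesis
      using k unfolding rhs width_inradius_ratio_def PInf by (simp add: one_ereal_def)
  next
    case MInf
    then show ?thesis using w0 by simp
  qed
qed

section \<open>Facet normals and vertices of a simplex\<close>

text \<open>The \<open>d + 1\<close> facets are indexed by \<open>'n option\<close>, where \<open>d = CARD('n)\<close>: the value \<open>None\<close> stands for
  the one facet whose normal is not a coordinate vector.  The vertex of index \<open>i\<close> is the one
  opposite to the facet of index \<open>i\<close>.\<close>

definition simplex_normal :: "'n::finite option \<Rightarrow> real ^ 'n" where
  "simplex_normal i = (case i of None \<Rightarrow> - (\<chi> j. 1) | Some k \<Rightarrow> axis k 1)"

definition simplex_vertex :: "'n::finite option \<Rightarrow> real ^ 'n" where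
  "simplex_vertex i =
    (\<chi> j. case i of None \<Rightarrow> 1 | Some k \<Rightarrow> if j = k then - real CARD('n) else 1)"

lemma simplex_normal_vertex:
  fixes i j :: "'n::finite option"
  shows "simplex_normal i \<bullet> simplex_vertex j = (if i = j then - real CARD('n) else 1)"
proof -
  have "(\<Sum>k\<in>UNIV. if k = l then - real CARD('n) else 1) = - 1" for l :: 'n
  proof -
    have "(\<Sum>k\<in>UNIV. if k = l then - real CARD('n) else 1)
        = - real CARD('n) + (\<Sum>k\<in>UNIV - {l}. 1)"
      by (subst sum.remove[of _ l]) (auto intro!: sum.cong)
    also have "\<dots> = - 1"
      by (simp add: card_Diff_singleton of_nat_diff Suc_leI)
    finally show ?thesis .
  qed
  then have vsum: "(\<Sum>k\<in>UNIV. simplex_vertex j $ k) = (if j = None then real CARD('n) else - 1)"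
    by (cases j) (simp_all add: simplex_vertex_def)
  show ?thesis
  proof (cases i)
    case None
    have "simplex_normal None \<bullet> simplex_vertex j = - (\<Sum>k\<in>UNIV. simplex_vertex j $ k)"
      by (simp add: simplex_normal_def inner_vec_def sum_negf)
    then show ?thesis using None by (simp add: vsum)
  next
    case (Some a)
    then have "simplex_normal i \<bullet> simplex_vertex j = simplex_vertex j $ a"
      by (simp add: simplex_normal_def inner_axis')
    then show ?thesis using Some by (cases j) (auto simp: simplex_vertex_def)
  qed
qed

lemma sum_simplex_normal: "(\<Sum>i\<in>UNIV. simplex_normal i) = (0 :: real ^ 'n::finite)"
proof -
  have "(\<Sum>i\<in>UNIV. simplex_normal (i :: 'n option)) = simplex_normal None + (\<Sum>k\<in>UNIV. axis k 1)"
    by (simp add: UNIV_option_conv sum.reindex simplex_normal_def)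
  also have "\<dots> = 0"
    by (simp add: vec_eq_iff simplex_normal_def axis_def)
  finally show ?thesis .
qed

text \<open>Averaging over \<open>i\<close> removes \<open>c\<close>, because the normals sum to zero.  In applications \<open>c\<close> is the
  centre of a homothet, \<open>M\<close> bounds the support values of one body and \<open>m\<close> is a support value
  that the other body attains in every direction.\<close>

lemma translate_bound:
  fixes c :: "real ^ 'n::finite"
  assumes "\<And>i. m \<le> simplex_normal i \<bullet> c + M"
  shows "m \<le> M"
proof -
  have "(\<Sum>i\<in>(UNIV :: 'n option set). m) \<le> (\<Sum>i\<in>UNIV. simplex_normal i \<bullet> c + M)"
    by (intro sum_mono assms)
  also have "\<dots> = (\<Sum>i\<in>(UNIV :: 'n option set). M)"
    by (simp add: sum.distrib sum_simplex_normal flip: inner_sum_left)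
  finally show ?thesis by simp
qed

section \<open>Two bodies of prescribed asymmetry\<close>

text \<open>The intersection of \<open>T\<close> and \<open>- s T\<close> for the simplex \<open>T\<close> with the facet normals above; it plays
  the role of \<open>K\<close>, and the antipodal hull that of \<open>C\<close>.\<close>

definition truncated_simplex :: "real \<Rightarrow> (real ^ 'n::finite) set" where
  "truncated_simplex s = {x. \<forall>i. - s \<le> simplex_normal i \<bullet> x \<and> simplex_normal i \<bullet> x \<le> 1}"

definition antipodal_simplex_hull :: "real \<Rightarrow> (real ^ 'n::finite) set" where
  "antipodal_simplex_hull t = convex hull
    (range (\<lambda>i. - (t / real CARD('n)) *\<^sub>R simplex_vertex i)
      \<union> range (\<lambda>i. (1 / real CARD('n)) *\<^sub>R simplex_vertex i))"

lemma scaled_vertices_mem_truncated_simplex: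
  fixes i :: "'n::finite option"
  assumes "s \<in> {1..real CARD('n)}"
  shows "(s / real CARD('n)) *\<^sub>R simplex_vertex i \<in> truncated_simplex s"
    and "- (1 / real CARD('n)) *\<^sub>R simplex_vertex i \<in> truncated_simplex s"
proof -
  define d where "d = real CARD('n)"
  have d: "s \<le> d" "1 \<le> s" "1 \<le> d" using assms by (auto simp: d_def)
  have "1 \<le> s * d" using mult_mono[OF d(2,3)] d by simp
  then have "- s \<le> s / d" "s / d \<le> 1" "- 1 \<le> s * d" "1 \<le> s * d"
    using d by (auto simp: field_simps intro: order_trans[of _ 0])
  then show "(s / real CARD('n)) *\<^sub>R simplex_vertex i \<in> truncated_simplex s"
    and "- (1 / real CARD('n)) *\<^sub>R simplex_vertex i \<in> truncated_simplex s"
    using d unfolding d_def[symmetric] truncated_simplex_def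
    by (auto simp: simplex_normal_vertex field_simps simp flip: d_def)
qed

lemma convex_body_truncated_simplex:
  assumes "1 \<le> s"
  shows "convex_body (truncated_simplex s :: (real ^ 'n::finite) set)"
proof -
  let ?K = "truncated_simplex s :: (real ^ 'n) set"
  have eq: "?K = (\<Inter>i. {x. simplex_normal i \<bullet> x \<ge> - s} \<inter> {x. simplex_normal i \<bullet> x \<le> 1})"
    by (auto simp: truncated_simplex_def)
  have "convex ?K" unfolding eq
    by (intro convex_INT convex_Int convex_halfspace_ge convex_halfspace_le)
  moreover have "closed ?K" unfolding eq
    by (intro closed_INT ballI closed_Int closed_halfspace_ge closed_halfspace_le)
  moreover have "bounded ?K"
  proof (rule bounded_subset[OF bounded_cbox[of "\<chi> i. - s" "\<chi> i. 1"]], rule subsetI)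
    fix x assume "x \<in> ?K"
    then have "- s \<le> simplex_normal (Some k) \<bullet> x \<and> simplex_normal (Some k) \<bullet> x \<le> 1" for k
      unfolding truncated_simplex_def by blast
    then show "x \<in> cbox (\<chi> i. - s) (\<chi> i. 1)"
      by (simp add: mem_box_cart simplex_normal_def inner_axis')
  qed
  moreover have "0 \<in> ?K" using assms by (simp add: truncated_simplex_def)
  ultimately show ?thesis
    by (auto simp: convex_body_def compact_eq_bounded_closed)
qed

text \<open>\<open>- K \<subseteq> s K\<close> is immediate from the inequalities, using \<open>1 \<le> s\<^sup>2\<close>.  It is optimal because every
  \<open>a\<^sub>i\<close> is bounded by \<open>1\<close> on \<open>K\<close> but takes the value \<open>s\<close> at the point \<open>- (s / d) v\<^sub>i\<close> of \<open>- K\<close>.\<close>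

lemma minkowski_asymmetry_truncated_simplex:
  assumes s: "s \<in> {1..real CARD('n::finite)}"
  shows "minkowski_asymmetry (truncated_simplex s :: (real ^ 'n) set) = ereal s"
proof (rule antisym)
  let ?K = "truncated_simplex s :: (real ^ 'n) set"
  have s1: "1 \<le> s" using s by simp
  have "uminus ` ?K \<subseteq> homothet 0 s ?K"
  proof clarify
    fix x :: "real ^ 'n" assume x: "x \<in> ?K"
    have bd: "- s \<le> simplex_normal i \<bullet> x" "simplex_normal i \<bullet> x \<le> 1" for i
      using x unfolding truncated_simplex_def by blast+
    have "1 \<le> s * s" using mult_mono[OF s1 s1] s1 by simp
    then have "simplex_normal i \<bullet> x \<le> s * s" for i using bd(2)[of i] by simp
    then have "- (1 / s) *\<^sub>R x \<in> ?K"
      using s1 bd by (auto simp: truncated_simplex_def field_simps)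
    moreover have "- x = 0 + s *\<^sub>R (- (1 / s) *\<^sub>R x)" using s1 by simp
    ultimately show "- x \<in> homothet 0 s ?K" unfolding homothet_def by blast
  qed
  then show "minkowski_asymmetry ?K \<le> ereal s"
    using s1 by (intro minkowski_asymmetry_le) auto
  show "ereal s \<le> minkowski_asymmetry ?K"
  proof (rule minkowski_asymmetry_ge)
    fix \<rho> and c :: "real ^ 'n"
    assume \<rho>: "0 \<le> \<rho>" "uminus ` ?K \<subseteq> homothet c \<rho> ?K"
    show "s \<le> \<rho>"
    proof (rule translate_bound)
      fix i :: "'n option"
      obtain y where y: "y \<in> ?K" "- ((s / real CARD('n)) *\<^sub>R simplex_vertex i) = c + \<rho> *\<^sub>R y"
        using \<rho>(2) scaled_vertices_mem_truncated_simplex(1)[OF s, of i]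
        unfolding homothet_def by blast
      have "s = simplex_normal i \<bullet> (- ((s / real CARD('n)) *\<^sub>R simplex_vertex i))"
        by (simp add: simplex_normal_vertex)
      also have "\<dots> = simplex_normal i \<bullet> c + \<rho> * (simplex_normal i \<bullet> y)"
        by (simp only: y(2) inner_add_right inner_scaleR_right)
      also have "\<dots> \<le> simplex_normal i \<bullet> c + \<rho>"
        using y(1) \<rho>(1) by (auto simp: truncated_simplex_def intro: mult_left_le)
      finally show "s \<le> simplex_normal i \<bullet> c + \<rho>" .
    qed
  qed
qed

lemma vertices_mem_antipodal_simplex_hull:
  fixes i :: "'n::finite option"
  shows "- (t / real CARD('n)) *\<^sub>R simplex_vertex i \<in> antipodal_simplex_hull t"
    and "(1 / real CARD('n)) *\<^sub>R simplex_vertex i \<in> antipodal_simplex_hull t"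
  unfolding antipodal_simplex_hull_def by (intro hull_inc UnI1 UnI2 rangeI)+

lemma antipodal_simplex_hull_induct:
  fixes S :: "(real ^ 'n::finite) set"
  assumes "convex S"
    and "\<And>i. - (t / real CARD('n)) *\<^sub>R simplex_vertex i \<in> S"
    and "\<And>i. (1 / real CARD('n)) *\<^sub>R simplex_vertex i \<in> S"
  shows "antipodal_simplex_hull t \<subseteq> S"
  unfolding antipodal_simplex_hull_def using assms by (intro hull_minimal) auto

lemma convex_body_antipodal_simplex_hull:
  "convex_body (antipodal_simplex_hull t :: (real ^ 'n::finite) set)"
  unfolding convex_body_def
proof (intro conjI)
  show "antipodal_simplex_hull t \<noteq> ({} :: (real ^ 'n) set)"
    using vertices_mem_antipodal_simplex_hull by blast
  show "compact (antipodal_simplex_hull t :: (real ^ 'n) set)"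
    unfolding antipodal_simplex_hull_def
    by (intro compact_convex_hull finite_imp_compact) simp
  show "convex (antipodal_simplex_hull t :: (real ^ 'n) set)"
    unfolding antipodal_simplex_hull_def by (rule convex_convex_hull)
qed

text \<open>\<open>- C \<subseteq> t C\<close> is checked on vertices, in the form \<open>C \<subseteq> - t C\<close>: the vertex \<open>- (t / d) v\<^sub>i\<close> is \<open>- t\<close>
  times the vertex \<open>(1 / d) v\<^sub>i\<close>, and \<open>(1 / d) v\<^sub>i\<close> is \<open>- t\<close> times a point of the segment that joins
  these two vertices.  It is optimal because \<open>- a\<^sub>i\<close> is bounded by \<open>1\<close> on \<open>C\<close> but takes the value
  \<open>t\<close> at the point \<open>(t / d) v\<^sub>i\<close> of \<open>- C\<close>.\<close>

lemma minkowski_asymmetry_antipodal_simplex_hull: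
  assumes t: "t \<in> {1..real CARD('n::finite)}"
  shows "minkowski_asymmetry (antipodal_simplex_hull t :: (real ^ 'n) set) = ereal t"
proof (rule antisym)
  let ?C = "antipodal_simplex_hull t :: (real ^ 'n) set" and ?d = "real CARD('n)"
  note V = vertices_mem_antipodal_simplex_hull[where 'n = 'n and t = t]
  have C: "convex ?C" using convex_body_antipodal_simplex_hull by (auto simp: convex_body_def)
  have t1: "1 \<le> t" "t \<le> ?d" using t by auto
  have "?C \<subseteq> (\<lambda>x. (- t) *\<^sub>R x) ` ?C"
  proof (rule antipodal_simplex_hull_induct)
    show "convex ((\<lambda>x. (- t) *\<^sub>R x) ` ?C)" by (intro convex_scaling C)
    fix i :: "'n option"
    show "- (t / ?d) *\<^sub>R simplex_vertex i \<in> (\<lambda>x. (- t) *\<^sub>R x) ` ?C"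
      by (rule image_eqI[OF _ V(2)[of i]]) simp
    \<comment> \<open>The weights are chosen so that the combination is \<open>- (1 / (t d)) v\<^sub>i\<close>.\<close>
    have "(1 / t) *\<^sub>R (- (t / ?d) *\<^sub>R simplex_vertex i)
        + (1 - 1 / t) *\<^sub>R ((1 / ?d) *\<^sub>R simplex_vertex i) \<in> ?C" (is "?p \<in> _")
      using t1 V by (intro convexD C) auto
    moreover have "(1 / ?d) *\<^sub>R simplex_vertex i = (- t) *\<^sub>R ?p"
    proof -
      have coeff: "- t * (1 / t * - (t / ?d) + (1 - 1 / t) * (1 / ?d)) = 1 / ?d"
        using t1 by (simp add: field_simps)
      show ?thesis
        by (simp only: scaleR_add_right scaleR_scaleR coeff flip: scaleR_add_left)
    qed
    ultimately show "(1 / ?d) *\<^sub>R simplex_vertex i \<in> (\<lambda>x. (- t) *\<^sub>R x) ` ?C"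
      by (rule rev_image_eqI)
  qed
  then have "uminus ` ?C \<subseteq> homothet 0 t ?C"
    by (force simp: homothet_def)
  then show "minkowski_asymmetry ?C \<le> ereal t"
    using t1 by (intro minkowski_asymmetry_le) auto
  show "ereal t \<le> minkowski_asymmetry ?C"
  proof (rule minkowski_asymmetry_ge)
    fix \<rho> and c :: "real ^ 'n"
    assume \<rho>: "0 \<le> \<rho>" "uminus ` ?C \<subseteq> homothet c \<rho> ?C"
    show "t \<le> \<rho>"
    proof (rule translate_bound[where c = "- c"])
      fix i :: "'n option"
      obtain y where y: "y \<in> ?C" "- (- (t / ?d) *\<^sub>R simplex_vertex i) = c + \<rho> *\<^sub>R y"
        using \<rho>(2) V(1)[of i] unfolding homothet_def by blast
      have "?C \<subseteq> {x. simplex_normal i \<bullet> x \<ge> - 1}"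
        using t1 by (intro antipodal_simplex_hull_induct convex_halfspace_ge)
          (auto simp: simplex_normal_vertex field_simps intro: order_trans[of _ 0])
      then have ay: "- 1 \<le> simplex_normal i \<bullet> y" using y(1) by blast
      have "- t = simplex_normal i \<bullet> (- (- (t / ?d) *\<^sub>R simplex_vertex i))"
        by (simp add: simplex_normal_vertex)
      also have "\<dots> = simplex_normal i \<bullet> c + \<rho> * (simplex_normal i \<bullet> y)"
        by (simp only: y(2) inner_add_right inner_scaleR_right)
      also have "\<dots> \<ge> simplex_normal i \<bullet> c + \<rho> * (- 1)"
        using mult_left_mono[OF ay \<rho>(1)] by simp
      finally show "t \<le> simplex_normal i \<bullet> (- c) + \<rho>" by simp
    qed
  qed
qed

section \<open>Sharpness\<close>

text \<open>\<open>C\<close> attains the value \<open>t\<close> of each \<open>a\<^sub>i\<close> at \<open>- (t / d) v\<^sub>i\<close>, while \<open>a\<^sub>i \<le> 1\<close> on \<open>K\<close>.\<close>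

lemma inradius_truncated_simplex_le:
  assumes t: "1 \<le> t"
  shows "inradius (truncated_simplex s :: (real ^ 'n::finite) set) (antipodal_simplex_hull t)
    \<le> ereal (1 / t)"
proof (rule inradius_le)
  let ?K = "truncated_simplex s :: (real ^ 'n) set"
  fix \<rho> and c :: "real ^ 'n"
  assume \<rho>: "0 \<le> \<rho>" "homothet c \<rho> (antipodal_simplex_hull t) \<subseteq> ?K"
  have "\<rho> * t \<le> 1"
  proof (rule translate_bound[where c = "- c"])
    fix i :: "'n option"
    have "c + \<rho> *\<^sub>R (- (t / real CARD('n)) *\<^sub>R simplex_vertex i) \<in> ?K"
      using \<rho>(2) vertices_mem_antipodal_simplex_hull(1)[of t i] unfolding homothet_def by blast
    then have "simplex_normal i \<bullet> (c + \<rho> *\<^sub>R (- (t / real CARD('n)) *\<^sub>R simplex_vertex i)) \<le> 1"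
      unfolding truncated_simplex_def by blast
    then show "\<rho> * t \<le> simplex_normal i \<bullet> (- c) + 1"
      by (simp add: inner_add_right inner_diff_right simplex_normal_vertex)
  qed
  then show "\<rho> \<le> 1 / t" using t by (simp add: field_simps)
qed

text \<open>In the coordinates \<open>a\<^sub>k \<bullet> x\<close>, the vector \<open>((s + 1) / (d + 1)) (v\<^sub>i - v\<^sub>j)\<close> has the entries \<open>- (s + 1)\<close> at
  \<open>i\<close>, \<open>s + 1\<close> at \<open>j\<close> and \<open>0\<close> elsewhere.  It is the difference of a point of \<open>K\<close> with entries
  \<open>- s\<close> at \<open>i\<close> and \<open>1\<close> at \<open>j\<close> and the point with these two entries exchanged.  As the coordinates
  of a point sum to zero, the remaining entries can all be \<open>l = (s - 1) / (d - 1)\<close>, which lies in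
  \<open>[0, 1]\<close>.\<close>

lemma edges_mem_difference_body_truncated_simplex:
  fixes i j :: "'n::finite option"
  assumes s: "s \<in> {1..real CARD('n)}" and \<mu>: "0 \<le> \<mu>" "\<mu> \<le> (s + 1) / (real CARD('n) + 1)"
  shows "\<mu> *\<^sub>R (simplex_vertex i - simplex_vertex j) \<in> difference_body (truncated_simplex s)"
proof (cases "i = j")
  case True
  then show ?thesis
    using convex_body_difference_body(2)[OF convex_body_truncated_simplex[where 'n = 'n]] s by simp
next
  case False
  define d where "d = real CARD('n)"
  have d: "s \<le> d" "1 \<le> s" "1 \<le> d" using s by (auto simp: d_def)
  \<comment> \<open>If \<open>d = 1\<close>, then \<open>s = 1\<close> and \<open>l = 0 / 0 = 0\<close>; there are no remaining entries.\<close>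
  define l where "l = (s - 1) / (d - 1)"
  have l: "0 \<le> l" "l \<le> 1" "l * (d - 1) = s - 1"
    using d by (auto simp: l_def divide_simps)
  \<comment> \<open>Writing \<open>s\<close> as \<open>l d + (1 - l)\<close>, the point interpolates between the cases \<open>s = d\<close> and \<open>s = 1\<close>.\<close>
  define p where "p i j = l *\<^sub>R simplex_vertex i
      + ((1 - l) / (d + 1)) *\<^sub>R (simplex_vertex i - simplex_vertex j)" for i j :: "'n option"
  have p: "p i j \<in> truncated_simplex s" if "i \<noteq> j" for i j
  proof -
    have "simplex_normal k \<bullet> p i j = (if k = i then - s else if k = j then 1 else l)" for k
    proof -
      have "simplex_normal k \<bullet> p i j = l * (simplex_normal k \<bullet> simplex_vertex i)
          + (1 - l) / (d + 1) * (simplex_normal k \<bullet> simplex_vertex i - simplex_normal k \<bullet> simplex_vertex j)"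
        by (simp add: p_def inner_add_right inner_diff_right)
      also have "\<dots> = (if k = i then - (l * d + (1 - l)) else if k = j then 1 else l)"
        using that d(3) by (auto simp: simplex_normal_vertex divide_simps simp flip: d_def) (auto simp: algebra_simps)
      also have "l * d + (1 - l) = s" using l(3) by (simp add: algebra_simps)
      finally show ?thesis .
    qed
    then show ?thesis
      using l d by (auto simp: truncated_simplex_def)
  qed
  let ?v = "simplex_vertex i - simplex_vertex j :: real ^ 'n"
  define e where "e = (1 - l) / (d + 1)"
  have "p i j - p j i = (l + e + e) *\<^sub>R ?v"
    by (simp only: p_def scaleR_add_left scaleR_diff_right flip: e_def)
      (simp add: algebra_simps del: scaleR_right_distrib)
  also have "l + e + e = (s + 1) / (d + 1)"
  proof -
    have "e * (d + 1) = 1 - l" using d by (simp add: e_def)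
    then have "(l + e + e) * (d + 1) = s + 1" using l(3) by (simp add: algebra_simps)
    then show ?thesis using d by (simp add: eq_divide_eq)
  qed
  finally have pp: "p i j - p j i = ((s + 1) / (d + 1)) *\<^sub>R ?v" .
  have "p i j - p j i \<in> difference_body (truncated_simplex s)"
    using p[of i j] p[of j i] False unfolding difference_body_def by blast
  then have E: "((s + 1) / (d + 1)) *\<^sub>R ?v \<in> difference_body (truncated_simplex s)"
    using pp by simp
  note D = convex_body_difference_body[OF convex_body_truncated_simplex[OF d(2), where 'n = 'n]]
  define w where "w = \<mu> / ((s + 1) / (d + 1))"
  have w: "0 \<le> w" "w \<le> 1" "w * ((s + 1) / (d + 1)) = \<mu>"
    using \<mu> d by (auto simp: w_def divide_simps simp flip: d_def)
  have "w *\<^sub>R (((s + 1) / (d + 1)) *\<^sub>R ?v) + (1 - w) *\<^sub>R 0 \<in> difference_body (truncated_simplex s)"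
    using D(1) w E D(2) by (intro convexD) (auto simp: convex_body_def)
  then show ?thesis using w(3) by simp
qed

lemma convex_affine_preimage:
  fixes S :: "'a::real_vector set"
  assumes "convex S"
  shows "convex {y. k *\<^sub>R (y - q) \<in> S}"
  unfolding convex_alt
proof (intro ballI allI impI, unfold mem_Collect_eq)
  fix x y u assume *: "k *\<^sub>R (x - q) \<in> S" "k *\<^sub>R (y - q) \<in> S" "0 \<le> u \<and> u \<le> (1::real)"
  have "k *\<^sub>R ((1 - u) *\<^sub>R x + u *\<^sub>R y - q)
      = (1 - u) *\<^sub>R (k *\<^sub>R (x - q)) + u *\<^sub>R (k *\<^sub>R (y - q))"
    by (simp add: algebra_simps)
  also have "\<dots> \<in> S" using assms * unfolding convex_alt by blast
  finally show "k *\<^sub>R ((1 - u) *\<^sub>R x + u *\<^sub>R y - q) \<in> S" .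
qed

text \<open>Put \<open>m = (s + 1) / (t + 1)\<close>; by convexity in each argument it suffices that \<open>m (p - q) \<in> K - K\<close>
  for vertices \<open>p\<close> and \<open>q\<close> of \<open>C\<close>.  If \<open>p\<close> and \<open>q\<close> are of the same kind, the difference is a multiple of
  an edge \<open>v\<^sub>i - v\<^sub>j\<close>, and \<open>m t / d \<le> (s + 1) / (d + 1)\<close> because \<open>t / (t + 1)\<close> increases with \<open>t \<le> d\<close>.
  Otherwise \<open>m (p - q)\<close> is, up to sign, a convex combination with weights \<open>1 / (t + 1)\<close> and
  \<open>t / (t + 1)\<close> of two vectors \<open>((s + 1) / d) v\<^sub>i\<close>, each of which is the difference of the points
  \<open>(s / d) v\<^sub>i\<close> and \<open>- (1 / d) v\<^sub>i\<close> of \<open>K\<close>.\<close>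

lemma half_width_truncated_simplex_ge:
  assumes s: "s \<in> {1..real CARD('n::finite)}" and t: "t \<in> {1..real CARD('n)}"
  shows "ereal ((s + 1) / (t + 1))
    \<le> half_width (truncated_simplex s :: (real ^ 'n) set) (antipodal_simplex_hull t)"
proof -
  let ?K = "truncated_simplex s :: (real ^ 'n) set" and ?C = "antipodal_simplex_hull t :: (real ^ 'n) set"
  define d where "d = real CARD('n)"
  define m where "m = (s + 1) / (t + 1)"
  define v where "v = (simplex_vertex :: 'n option \<Rightarrow> _)"
  have s1: "1 \<le> s" "s \<le> d" and t1: "1 \<le> t" "t \<le> d" using s t by (auto simp: d_def)
  have K: "convex_body ?K" by (rule convex_body_truncated_simplex[OF s1(1)])
  note D = convex_body_difference_body[OF K]
  have cD: "convex (difference_body ?K)" using D(1) by (auto simp: convex_body_def)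
  have m: "0 \<le> m" using s1 t1 by (simp add: m_def)
  have vertex_mem: "((s + 1) / d) *\<^sub>R v i \<in> difference_body ?K" for i
  proof -
    have "(s / d) *\<^sub>R v i - (- (1 / d) *\<^sub>R v i) \<in> difference_body ?K"
      using scaled_vertices_mem_truncated_simplex[OF s, of i]
      unfolding difference_body_def d_def v_def by blast
    then show ?thesis by (simp add: add_divide_distrib scaleR_add_left)
  qed
  have edge_mem: "m *\<^sub>R (x *\<^sub>R v i - x *\<^sub>R v j) \<in> difference_body ?K"
    if "0 \<le> x" "x \<le> t / d" for x i j
  proof -
    have "m * x \<le> (s + 1) / (d + 1)"
    proof -
      have "m * x \<le> m * (t / d)" using that m by (intro mult_left_mono)
      also have "\<dots> \<le> (s + 1) / (d + 1)"
      proof -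
        have "t / (t + 1) \<le> d / (d + 1)" using s1 t1 by (simp add: field_simps)
        then have "(s + 1) / d * (t / (t + 1)) \<le> (s + 1) / d * (d / (d + 1))"
          using s1 by (intro mult_left_mono) auto
        then show ?thesis using s1 by (simp add: m_def mult.commute)
      qed
      finally show ?thesis .
    qed
    then have "(m * x) *\<^sub>R (v i - v j) \<in> difference_body ?K"
      unfolding v_def d_def using m that by (intro edges_mem_difference_body_truncated_simplex s) auto
    then show ?thesis by (simp add: scaleR_diff_right)
  qed
  have mixed_mem: "m *\<^sub>R ((1 / d) *\<^sub>R v i + (t / d) *\<^sub>R v j) \<in> difference_body ?K" for i j
  proof -
    have "(1 / (t + 1)) *\<^sub>R (((s + 1) / d) *\<^sub>R v i) + (t / (t + 1)) *\<^sub>R (((s + 1) / d) *\<^sub>R v j)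
        \<in> difference_body ?K"
      using t1 by (intro convexD[OF cD] vertex_mem) (auto simp: divide_simps)
    then show ?thesis by (simp add: m_def scaleR_add_right mult.commute)
  qed
  have td: "0 \<le> 1 / d" "1 / d \<le> t / d" "0 \<le> t / d" "t / d \<le> t / d"
    using s1 t1 by (auto simp: divide_right_mono)
  have cvx: "convex {y. m *\<^sub>R (y - q) \<in> difference_body ?K}"
            "convex {y. m *\<^sub>R (q - y) \<in> difference_body ?K}" for q
    using convex_affine_preimage[OF cD, of m q] convex_affine_preimage[OF cD, of "- m" q]
    by (simp_all flip: scaleR_minus_right)
  have one: "m *\<^sub>R (p - q) \<in> difference_body ?K"
    if p: "p \<in> range (\<lambda>i. - (t / d) *\<^sub>R v i) \<union> range (\<lambda>i. (1 / d) *\<^sub>R v i)" and q: "q \<in> ?C" for p q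
  proof -
    have "?C \<subseteq> {y. m *\<^sub>R (p - y) \<in> difference_body ?K}"
    proof (intro antipodal_simplex_hull_induct cvx, unfold mem_Collect_eq d_def[symmetric] v_def[symmetric])
      fix j
      from p consider i where "p = - (t / d) *\<^sub>R v i" | i where "p = (1 / d) *\<^sub>R v i" by blast
      note p_cases = this
      show "m *\<^sub>R (p - (- (t / d) *\<^sub>R v j)) \<in> difference_body ?K"
        using p_cases
      proof cases
        case (1 i)
        then show ?thesis using edge_mem[OF td(3,4), of j i] by (simp add: algebra_simps)
      next
        case (2 i)
        then show ?thesis using mixed_mem[of i j] by simp
      qed
      show "m *\<^sub>R (p - (1 / d) *\<^sub>R v j) \<in> difference_body ?K"
        using p_cases
      proof cases
        case (1 i)
        then have "m *\<^sub>R (p - (1 / d) *\<^sub>R v j) = - (m *\<^sub>R ((1 / d) *\<^sub>R v j + (t / d) *\<^sub>R v i))"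
          by (simp add: algebra_simps)
        then show ?thesis using D(3)[OF mixed_mem[of j i]] by simp
      next
        case (2 i)
        then show ?thesis using edge_mem[OF td(1,2), of i j] by simp
      qed
    qed
    then show ?thesis using q by blast
  qed
  have "m *\<^sub>R (p - q) \<in> difference_body ?K" if "p \<in> ?C" "q \<in> ?C" for p q
  proof -
    have "?C \<subseteq> {y. m *\<^sub>R (y - q) \<in> difference_body ?K}"
      using that(2) by (intro antipodal_simplex_hull_induct cvx, unfold mem_Collect_eq d_def[symmetric] v_def[symmetric])
        (rule one[OF _ that(2)], blast)+
    then show ?thesis using that(1) by blast
  qed
  then have "\<forall>z \<in> difference_body ?C. m *\<^sub>R z \<in> difference_body ?K"
    by (auto simp: difference_body_def[of ?C])
  then show ?thesis
    using half_width_ge_iff[OF K convex_body_antipodal_simplex_hull m] by (simp add: m_def)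
qed

theorem corollary4p3:
  shows "(\<forall>K C :: (real ^ 'n) set.
            convex_body K \<and> convex_body C \<and> \<not> is_singleton K \<and> \<not> is_singleton C \<longrightarrow>
            width_inradius_ratio K C
              \<le> (minkowski_asymmetry K + 1) * minkowski_asymmetry C / (minkowski_asymmetry C + 1))
       \<and> (\<forall>\<sigma>K \<sigma>C :: real.
            \<sigma>K \<in> {1..real CARD('n)} \<and> \<sigma>C \<in> {1..real CARD('n)} \<longrightarrow>
            (\<exists>K C :: (real ^ 'n) set.
               convex_body K \<and> convex_body C \<and>
               minkowski_asymmetry K = ereal \<sigma>K \<and> minkowski_asymmetry C = ereal \<sigma>C \<and>
               width_inradius_ratio K C
                 = (minkowski_asymmetry K + 1) * minkowski_asymmetry C
                     / (minkowski_asymmetry C + 1)))"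
proof (intro conjI allI impI)
  fix K C :: "(real ^ 'n) set"
  assume "convex_body K \<and> convex_body C \<and> \<not> is_singleton K \<and> \<not> is_singleton C"
  then show "width_inradius_ratio K C
      \<le> (minkowski_asymmetry K + 1) * minkowski_asymmetry C / (minkowski_asymmetry C + 1)"
    by (intro width_inradius_ratio_le) auto
next
  fix s t :: real
  assume "s \<in> {1..real CARD('n)} \<and> t \<in> {1..real CARD('n)}"
  then have s: "s \<in> {1..real CARD('n)}" and t: "t \<in> {1..real CARD('n)}" by auto
  let ?K = "truncated_simplex s :: (real ^ 'n) set" and ?C = "antipodal_simplex_hull t :: (real ^ 'n) set"
  have s1: "1 \<le> s" and t1: "1 \<le> t" using s t by auto
  have K: "convex_body ?K" "minkowski_asymmetry ?K = ereal s"
    using convex_body_truncated_simplex[OF s1] minkowski_asymmetry_truncated_simplex[OF s] by auto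
  have C: "convex_body ?C" "minkowski_asymmetry ?C = ereal t"
    using convex_body_antipodal_simplex_hull minkowski_asymmetry_antipodal_simplex_hull[OF t] by auto
  have not_single: "\<not> is_singleton ?K" "\<not> is_singleton ?C"
    using K(2) C(2) s1 t1 by (auto simp: is_singleton_def minkowski_asymmetry_singleton)
  let ?q = "(minkowski_asymmetry ?K + 1) * minkowski_asymmetry ?C / (minkowski_asymmetry ?C + 1)"
  have q: "?q = ereal ((s + 1) / (t + 1) / (1 / t))"
    using t1 by (simp add: K C one_ereal_def)
  have hw: "ereal ((s + 1) / (t + 1)) \<le> half_width ?K ?C"
    by (rule half_width_truncated_simplex_ge[OF s t])
  have ir: "0 \<le> inradius ?K ?C" "inradius ?K ?C \<le> ereal (1 / t)"
    using inradius_nonneg[of ?K ?C] K(1) inradius_truncated_simplex_le[OF t1]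
    by (auto simp: convex_body_def)
  have pos: "0 < (s + 1) / (t + 1)" using s1 t1 by simp
  have "0 < half_width ?K ?C" using pos hw by (metis ereal_less(2) less_le_trans)
  then have ratio: "width_inradius_ratio ?K ?C = half_width ?K ?C / inradius ?K ?C"
    using ir by (auto simp: width_inradius_ratio_def)
  have "?q \<le> half_width ?K ?C / inradius ?K ?C"
  proof (cases "inradius ?K ?C = 0")
    case True
    have "half_width ?K ?C / inradius ?K ?C = \<infinity>"
      unfolding True using \<open>0 < half_width ?K ?C\<close> by (simp add: divide_ereal_def)
    then show ?thesis by simp
  next
    case False
    then obtain r where r: "inradius ?K ?C = ereal r" "0 < r" "r \<le> 1 / t"
      using ir by (cases "inradius ?K ?C") auto
    have "(s + 1) / (t + 1) / (1 / t) \<le> (s + 1) / (t + 1) / r"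
      using r pos t1 by (intro divide_left_mono) auto
    then have "?q \<le> ereal ((s + 1) / (t + 1)) / inradius ?K ?C"
      unfolding q r(1) using r(2) by simp
    also have "\<dots> \<le> half_width ?K ?C / inradius ?K ?C"
      using hw r by (intro ereal_divide_right_mono) auto
    finally show ?thesis .
  qed
  then have "width_inradius_ratio ?K ?C = ?q"
    using width_inradius_ratio_le[OF K(1) not_single(1) C(1) not_single(2)] ratio by simp
  with K C show "\<exists>K C :: (real ^ 'n) set. convex_body K \<and> convex_body C \<and>
      minkowski_asymmetry K = ereal s \<and> minkowski_asymmetry C = ereal t \<and>
      width_inradius_ratio K C
        = (minkowski_asymmetry K + 1) * minkowski_asymmetry C / (minkowski_asymmetry C + 1)"
    by blast
qed

end
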